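(* Let $f(X)=a_0+a_1X+\cdots+a_nX^n$ be a polynomial with integer coefficients, $M$ the maximum of the absolute values of its (complex) roots, and assume that for two integers $a,b$ we have $0<|f(a)|<|f(b)|$. Let $$q=\max\left\{\frac{d_2}{d_1}\le\sqrt{\frac{|f(b)|}{|f(a)|}}\;:\; d_1\in\mathcal{D}_{ad}(f(a)),\ d_2\in\mathcal{D}_{ad}(f(b))\right\}.$$ Then: (i) If $|b|>q|a|+(1+q)M$, then $f$ is irreducible over $\mathbb{Q}$. (ii) If $|b|>\sqrt q\,|a|+(1+\sqrt q)M$ and $f$ has no rational roots, then $f$ is irreducible over $\mathbb{Q}$. (iii) If $q=1$, $a^2<b^2$ and $M<\frac{|a+b|}{2}$, then $f$ is irreducible over $\mathbb{Q}$.
   Context: Admissible divisors: for a non-constant polynomial $f\in\mathbb{Z}[X]$ and an integer $a$ with $f(a)\neq 0$, an integer $d$ is an admissible divisor of $f(a)$ if $d\mid f(a)$ and $\gcd\left(d,\frac{f(a)}{d}\right)\mid\gcd(f(a),f'(a))$, where $f'$ is the derivative of $f$. The set of all admissible divisors of $f(a)$ is denoted $\mathcal{D}_{ad}(f(a))$ (it depends on $f$ and $a$, not only on the integer $f(a)$). *)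

theory Defs
  imports Complex_Main "HOL-Computational_Algebra.Computational_Algebra"
begin

text \<open>Divisors may be negative. The set depends on the pair \<open>f\<close>, \<open>a\<close>, not only on the
  integer \<open>f(a)\<close>; it is meaningful for \<open>f(a) \<noteq> 0\<close>, in which case \<open>0\<close> is not a member.\<close>

definition admissible_divisors :: "int poly \<Rightarrow> int \<Rightarrow> int set" where
  "admissible_divisors f a =
     {d. d dvd poly f a \<and> gcd d (poly f a div d) dvd gcd (poly f a) (poly (pderiv f) a)}"

definition max_root_abs :: "int poly \<Rightarrow> real" where
  "max_root_abs f = Max {cmod z | z. poly (map_poly of_int f) z = 0}"

definition admissible_quotients :: "int poly \<Rightarrow> int \<Rightarrow> int \<Rightarrow> real set" where
  "admissible_quotients f a b =
     {real_of_int d2 / real_of_int d1 | d1 d2.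
        d1 \<in> admissible_divisors f a \<and> d2 \<in> admissible_divisors f b \<and>
        real_of_int d2 / real_of_int d1
          \<le> sqrt (real_of_int \<bar>poly f b\<bar> / real_of_int \<bar>poly f a\<bar>)}"

text \<open>Under the hypothesis \<open>0 < \<bar>f(a)\<bar> < \<bar>f(b)\<bar>\<close> (which forces \<open>f\<close> to be non-constant) both
  maxima are taken over finite non-empty sets, so \<^const>\<open>Max\<close> is the genuine maximum.\<close>

lemma finite_admissible_divisors:
  assumes "poly f a \<noteq> 0"
  shows "finite (admissible_divisors f a)"
  by (rule finite_subset[OF _ finite_divisors_int[OF assms]])
     (auto simp: admissible_divisors_def)

lemma admissible_quotients_finite_nonempty:
  assumes "0 < \<bar>poly f a\<bar>" and "\<bar>poly f a\<bar> < \<bar>poly f b\<bar>"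
  shows "finite (admissible_quotients f a b)" and "1 \<in> admissible_quotients f a b"
proof -
  have "admissible_quotients f a b \<subseteq> (\<lambda>(d1, d2). real_of_int d2 / real_of_int d1) `
          (admissible_divisors f a \<times> admissible_divisors f b)"
    by (auto simp: admissible_quotients_def)
  then show "finite (admissible_quotients f a b)"
    using assms
    by (auto intro!: finite_cartesian_product finite_admissible_divisors elim!: finite_subset)
  have one: "1 \<in> admissible_divisors f c" for c
    by (simp add: admissible_divisors_def)
  have "1 \<le> sqrt (real_of_int \<bar>poly f b\<bar> / real_of_int \<bar>poly f a\<bar>)"
    using assms by (simp add: field_simps)
  then show "1 \<in> admissible_quotients f a b"
    unfolding admissible_quotients_def using one[of a] one[of b]
    by (intro CollectI exI[of _ 1]) auto
qed

lemma root_abs_finite_nonempty: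
  assumes "0 < \<bar>poly f a\<bar>" and "\<bar>poly f a\<bar> < \<bar>poly f b\<bar>"
  shows "finite {cmod z | z. poly (map_poly of_int f) z = 0}"
    and "{cmod z | z. poly (map_poly of_int f) z = 0} \<noteq> {}"
proof -
  let ?F = "map_poly of_int f :: complex poly"
  have deg: "degree f \<noteq> 0"
  proof
    assume "degree f = 0"
    then obtain c where "f = [:c:]" by (rule degree_eq_zeroE)
    with assms(2) show False by simp
  qed
  have degF: "degree ?F = degree f" by (intro degree_map_poly) auto
  with deg have "?F \<noteq> 0" by auto
  then have "finite {z. poly ?F z = 0}" by (rule poly_roots_finite)
  then show "finite {cmod z | z. poly ?F z = 0}" by (rule finite_image_set)
  have "\<not> constant (poly ?F)" using deg degF by (simp add: constant_degree)
  then show "{cmod z | z. poly ?F z = 0} \<noteq> {}"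
    using fundamental_theorem_of_algebra by auto
qed

end

theory Submission imports Defs begin

text \<open>If \<open>f = g h\<close> with non-constant integer factors, then \<open>g(a), g(b), h(a), h(b)\<close> are all
  admissible: a common divisor of \<open>g(a)\<close> and \<open>h(a)\<close> divides \<open>f' (a) = g'(a) h(a) + g(a) h'(a)\<close>.
  The product of \<open>\<bar>g(b) / g(a)\<bar>\<close> and \<open>\<bar>h(b) / h(a)\<bar>\<close> is \<open>\<bar>f(b) / f(a)\<bar>\<close>, so one of the two
  factors, say \<open>g\<close>, satisfies \<open>\<bar>g(b) / g(a)\<bar> \<le> q\<close>. Writing \<open>g\<close> as a product over its roots,
  \<open>\<bar>g(b) / g(a)\<bar> = \<Prod> \<bar>b - \<theta>\<bar> / \<bar>a - \<theta>\<bar>\<close>, and the hypotheses make every factor exceed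
  \<open>q\<close>, \<open>\<surd>q\<close> and \<open>1\<close> respectively, which is a contradiction; in the second case
  \<open>deg g \<ge> 2\<close> because \<open>g\<close> has no rational root.\<close>

lemma map_poly_of_int_mult:
  "map_poly of_int (p * q) = (map_poly of_int p * map_poly of_int q :: 'a::comm_ring_1 poly)"
  by (rule poly_eqI) (simp add: coeff_map_poly coeff_mult)

lemma map_poly_of_int_smult:
  "map_poly of_int (smult c p) = (smult (of_int c) (map_poly of_int p) :: 'a::comm_ring_1 poly)"
  by (rule poly_eqI) (simp add: coeff_map_poly)

lemma map_poly_of_int_eq_iff:
  "map_poly of_int p = (map_poly of_int q :: 'a::{comm_ring_1, ring_char_0} poly) \<longleftrightarrow> p = q"
  by (auto simp: poly_eq_iff coeff_map_poly)

lemma degree_map_poly_of_int: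
  "degree (map_poly of_int p :: 'a::{comm_ring_1, ring_char_0} poly) = degree p"
  by (rule degree_map_poly) auto

lemma poly_map_poly_of_int:
  "poly (map_poly of_int p) (of_int x :: 'a::comm_ring_1) = of_int (poly p x)"
  by (induction p) (simp_all add: map_poly_pCons)

text \<open>Denominators are cleared one coefficient at a time; their product need not be the least
  common multiple, as only \<open>m \<noteq> 0\<close> matters.\<close>

lemma rat_poly_clear_denominators:
  fixes G :: "rat poly"
  obtains m :: int and g where "m \<noteq> 0" "smult (of_int m) G = map_poly of_int g"
proof -
  have "\<exists>m g. m \<noteq> 0 \<and> smult (of_int m) G = map_poly of_int g"
  proof (induction G)
    case 0
    show ?case by (intro exI[of _ 1] exI[of _ 0]) simp
  next
    case (pCons c G)
    then obtain m g where mg: "m \<noteq> 0" "smult (of_int m) G = map_poly of_int g" by blast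
    obtain n d where nd: "quotient_of c = (n, d)" by fastforce
    have d: "d > 0" and c: "c = of_int n / of_int d"
      using quotient_of_denom_pos[OF nd] quotient_of_div[OF nd] by auto
    \<comment> \<open>The new constant coefficient is \<open>d * m * c = n * m\<close>, and the
      others, already integral after scaling by \<open>m\<close>, pick up \<open>d\<close>.\<close>
    have "smult (of_int (d * m)) (pCons c G) = map_poly of_int (pCons (n * m) (smult d g))"
      using d by (simp add: c map_poly_pCons map_poly_of_int_smult flip: mg(2))
    with mg(1) d show ?case by (metis mult_eq_0_iff less_irrefl)
  qed
  then show ?thesis using that by blast
qed

text \<open>This is Gauss's lemma: after clearing denominators, multiplicativity of the primitive
  part removes the spurious factor \<open>m * n\<close> up to sign. The degrees survive, so both
  factors stay non-constant.\<close>

lemma reducible_rat_imp_int_factors: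
  fixes f :: "int poly"
  assumes deg: "degree f > 0" and red: "\<not> irreducible (map_poly rat_of_int f)"
  obtains g h where "f = g * h" "degree g > 0" "degree h > 0"
proof -
  let ?F = "map_poly rat_of_int f"
  have dF: "degree ?F > 0" using deg by (simp add: degree_map_poly_of_int)
  then have F0: "?F \<noteq> 0" by auto
  with dF have Fu: "\<not> is_unit ?F" by (simp add: is_unit_iff_degree)
  with F0 obtain G H where F: "?F = G * H" and GH: "\<not> is_unit G" "\<not> is_unit H"
    using red by (auto simp: irreducible_def)
  have G: "degree G > 0" and H: "degree H > 0"
    using GH F F0 by (auto simp: is_unit_iff_degree)
  obtain m g where m: "m \<noteq> 0" and g: "smult (of_int m) G = map_poly of_int g"
    by (rule rat_poly_clear_denominators)
  obtain n h where n: "n \<noteq> 0" and h: "smult (of_int n) H = map_poly of_int h"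
    by (rule rat_poly_clear_denominators)
  have "map_poly rat_of_int (smult (m * n) f) = map_poly rat_of_int (g * h)"
    by (simp add: map_poly_of_int_smult map_poly_of_int_mult F mult.commute flip: g h)
  then have eq: "smult (m * n) f = g * h"
    by (simp only: map_poly_of_int_eq_iff)
  have dg: "degree g = degree G" and dh: "degree h = degree H"
    using m n arg_cong[OF g, of degree] arg_cong[OF h, of degree]
    by (simp_all add: degree_map_poly_of_int)
  have "smult (unit_factor (m * n)) (primitive_part f) = primitive_part g * primitive_part h"
    using arg_cong[OF eq, of primitive_part]
    by (simp add: primitive_part_smult primitive_part_mult)
  \<comment> \<open>The unit factor is 1 or -1, so multiplying by it once more cancels it on the
    left.\<close>
  then have "smult (unit_factor (m * n)) (smult (unit_factor (m * n)) (primitive_part f))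
      = smult (unit_factor (m * n)) (primitive_part g * primitive_part h)"
    by simp
  then have "primitive_part f = smult (unit_factor (m * n)) (primitive_part g * primitive_part h)"
    using m n by (simp add: sgn_mult sgn_if split: if_splits)
  then have "f = smult (content f * unit_factor (m * n)) (primitive_part g) * primitive_part h"
    using content_times_primitive_part[of f] by (metis mult_smult_left smult_smult)
  moreover have "content f * unit_factor (m * n) \<noteq> 0"
    using m n deg by (auto simp: sgn_if)
  ultimately show ?thesis
    using that G H dg dh by (metis degree_primitive_part degree_smult_eq)
qed

text \<open>The absolute value serves to make quotients of such divisors nonnegative. It changes the
  cofactor \<open>h(a)\<close> at most by a sign, which the gcd ignores.\<close>

lemma admissible_divisors_factor:
  assumes "poly (g * h) a \<noteq> 0"
  shows "\<bar>poly g a\<bar> \<in> admissible_divisors (g * h) a"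
proof -
  have nz: "poly g a \<noteq> 0" using assms by auto
  have "poly (g * h) a = \<bar>poly g a\<bar> * (sgn (poly g a) * poly h a)"
    by (simp add: abs_mult_sgn flip: mult.assoc)
  then have "poly (g * h) a div \<bar>poly g a\<bar> = sgn (poly g a) * poly h a"
    using nz by (metis abs_eq_0 nonzero_mult_div_cancel_left)
  then have eq: "gcd \<bar>poly g a\<bar> (poly (g * h) a div \<bar>poly g a\<bar>) = gcd (poly g a) (poly h a)"
    using nz by (simp add: sgn_if)
  have "gcd (poly g a) (poly h a) dvd gcd (poly (g * h) a) (poly (pderiv (g * h)) a)"
    by (auto simp: pderiv_mult intro!: gcd_greatest dvd_add dvd_mult dvd_mult2)
  with eq show ?thesis by (simp add: admissible_divisors_def)
qed

lemma admissible_quotients_factor: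
  assumes "f = g * h" "poly f a \<noteq> 0"
    and "real_of_int \<bar>poly g b\<bar> / real_of_int \<bar>poly g a\<bar>
      \<le> sqrt (real_of_int \<bar>poly f b\<bar> / real_of_int \<bar>poly f a\<bar>)" "poly f b \<noteq> 0"
  shows "real_of_int \<bar>poly g b\<bar> / real_of_int \<bar>poly g a\<bar> \<in> admissible_quotients f a b"
  using assms admissible_divisors_factor[of g h]
  unfolding admissible_quotients_def by blast

text \<open>Induction splits off one root at a time; the leading coefficient occurs on both sides.
  Stating the bound without quotients avoids dividing by values that might vanish.\<close>

lemma poly_norm_lower_bound:
  fixes p :: "complex poly"
  assumes "degree p > 0" and "s \<ge> 0"
    and "\<And>z. poly p z = 0 \<Longrightarrow> s * cmod (x - z) < cmod (y - z)"
  shows "s ^ degree p * cmod (poly p x) < cmod (poly p y)"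
  using assms
proof (induction "degree p" arbitrary: p)
  case (Suc n)
  have "\<not> constant (poly p)"
    using Suc.prems(1) by (simp add: constant_degree)
  then obtain z where z: "poly p z = 0"
    using fundamental_theorem_of_algebra by blast
  then obtain r where r: "p = [:- z, 1:] * r" by (auto simp: poly_eq_0_iff_dvd)
  have r0: "r \<noteq> 0" using r Suc.prems(1) by auto
  then have dp: "degree p = Suc (degree r)" unfolding r by (subst degree_mult_eq) auto
  have root: "s * cmod (x - z) < cmod (y - z)" using Suc.prems(3) z by blast
  \<comment> \<open>The cofactor may be constant, so only the weak inequality survives here.
    Positivity at \<open>y\<close> lets the strict inequality at the root \<open>z\<close> carry the
    product.\<close>
  have r_bound: "s ^ degree r * cmod (poly r x) \<le> cmod (poly r y) \<and> cmod (poly r y) > 0"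
  proof (cases "degree r = 0")
    case True
    then obtain c where "r = [:c:]" by (rule degree_eq_zeroE)
    with r0 show ?thesis by simp
  next
    case False
    then have "s ^ degree r * cmod (poly r x) < cmod (poly r y)"
      using Suc.hyps(2) dp Suc.prems(2,3) by (intro Suc.hyps(1)) (auto simp: r)
    moreover have "0 \<le> s ^ degree r * cmod (poly r x)" using Suc.prems(2) by simp
    ultimately show ?thesis by linarith
  qed
  have "s ^ degree p * cmod (poly p x)
      = (s * cmod (x - z)) * (s ^ degree r * cmod (poly r x))"
    by (simp add: dp) (simp add: r norm_mult flip: left_diff_distrib)
  also have "\<dots> \<le> (s * cmod (x - z)) * cmod (poly r y)"
    using r_bound Suc.prems(2) by (intro mult_left_mono) auto
  also have "\<dots> < cmod (y - z) * cmod (poly r y)"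
    using root r_bound by (intro mult_strict_right_mono) auto
  also have "\<dots> = cmod (poly p y)"
    by (simp add: r norm_mult flip: left_diff_distrib)
  finally show ?case .
qed simp

text \<open>This is the common core of the three criteria, which take \<open>s\<close> to be
  \<open>q\<close>, \<open>sqrt q\<close> and \<open>1\<close>.\<close>

lemma reducible_imp_factor_power_less:
  fixes f :: "int poly" and a b :: int and s :: real
  assumes fa: "0 < \<bar>poly f a\<bar>" and fb: "\<bar>poly f a\<bar> < \<bar>poly f b\<bar>"
    and red: "\<not> irreducible (map_poly rat_of_int f)" and s: "s \<ge> 0"
    and roots: "\<And>z. poly (map_poly of_int f) z = 0 \<Longrightarrow>
      s * cmod (of_int a - z) < cmod (of_int b - z)"
  obtains g where "g dvd f" "degree g > 0" "s ^ degree g < Max (admissible_quotients f a b)"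
proof -
  let ?R = "\<lambda>g. real_of_int \<bar>poly g b\<bar> / real_of_int \<bar>poly g a\<bar>"
  have "degree f > 0"
  proof (rule ccontr)
    assume "\<not> degree f > 0"
    then obtain c where "f = [:c:]" by (auto elim: degree_eq_zeroE)
    with fb show False by simp
  qed
  then obtain g h where gh: "f = g * h" "degree g > 0" "degree h > 0"
    using red by (rule reducible_rat_imp_int_factors)
  \<comment> \<open>The ratios of the two factors multiply to that of \<open>f\<close>, so they
    cannot both exceed its square root; the roles of \<open>g\<close> and \<open>h\<close> may be
    swapped.\<close>
  have "\<exists>g h. f = g * h \<and> degree g > 0 \<and> ?R g \<le> sqrt (?R f)"
  proof (rule ccontr)
    assume "\<not> ?thesis"
    with gh have "?R g > sqrt (?R f)" "?R h > sqrt (?R f)"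
      by (auto simp: not_le mult.commute[of g h] dest: spec[of _ g] spec[of _ h])
    then have "sqrt (?R f) * sqrt (?R f) < ?R g * ?R h"
      by (intro mult_strict_mono') auto
    then show False by (simp add: gh(1) abs_mult)
  qed
  then obtain g h where gh: "f = g * h" "degree g > 0" "?R g \<le> sqrt (?R f)" by blast
  have nz: "poly g a \<noteq> 0" using fa gh(1) by auto
  have "?R g \<in> admissible_quotients f a b"
    using gh fa fb by (intro admissible_quotients_factor) auto
  then have "?R g \<le> Max (admissible_quotients f a b)"
    using admissible_quotients_finite_nonempty(1)[OF fa fb] by simp
  moreover have "s ^ degree g < ?R g"
  proof -
    let ?G = "map_poly of_int g :: complex poly"
    have "s ^ degree ?G * cmod (poly ?G (of_int a)) < cmod (poly ?G (of_int b))"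
      using s gh(2) roots
      by (intro poly_norm_lower_bound) (auto simp: degree_map_poly_of_int gh(1) map_poly_of_int_mult)
    with nz show ?thesis
      by (simp add: degree_map_poly_of_int poly_map_poly_of_int field_simps)
  qed
  ultimately show ?thesis using gh by (intro that[of g]) auto
qed

lemma degree_1_imp_rat_root:
  fixes g :: "int poly"
  assumes "degree g = 1"
  obtains x where "poly (map_poly rat_of_int g) x = 0"
proof -
  obtain c d where g: "g = [:c, d:]" "d \<noteq> 0" using degree1_coeffs assms by blast
  show ?thesis
    by (rule that[of "- of_int c / of_int d"]) (use g in \<open>simp add: map_poly_pCons\<close>)
qed

theorem theorem1p3:
  fixes f :: "int poly" and a b :: int and M q :: real
  assumes "0 < \<bar>poly f a\<bar>" and "\<bar>poly f a\<bar> < \<bar>poly f b\<bar>"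
    and "M = max_root_abs f"
    and "q = Max (admissible_quotients f a b)"
  shows "(real_of_int \<bar>b\<bar> > q * real_of_int \<bar>a\<bar> + (1 + q) * M
            \<longrightarrow> irreducible (map_poly rat_of_int f))
       \<and> (real_of_int \<bar>b\<bar> > sqrt q * real_of_int \<bar>a\<bar> + (1 + sqrt q) * M
            \<and> (\<forall>x :: rat. poly (map_poly rat_of_int f) x \<noteq> 0)
            \<longrightarrow> irreducible (map_poly rat_of_int f))
       \<and> (q = 1 \<and> a\<^sup>2 < b\<^sup>2 \<and> M < real_of_int \<bar>a + b\<bar> / 2
            \<longrightarrow> irreducible (map_poly rat_of_int f))"
proof -
  let ?F = "map_poly of_int f :: complex poly"
  have q1: "q \<ge> 1"
    using admissible_quotients_finite_nonempty[OF assms(1,2)] assms(4) by simp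
  have M: "cmod z \<le> M" if "poly ?F z = 0" for z
    unfolding assms(3) max_root_abs_def
    by (rule Max_ge[OF root_abs_finite_nonempty(1)[OF assms(1,2)]]) (use that in blast)
  have factor: "\<exists>g. g dvd f \<and> degree g > 0 \<and> s ^ degree g < q"
    if "\<not> irreducible (map_poly rat_of_int f)" "s \<ge> 0"
      "\<And>z. poly ?F z = 0 \<Longrightarrow> s * cmod (of_int a - z) < cmod (of_int b - z)" for s
    using reducible_imp_factor_power_less[OF assms(1,2) that] assms(4) by metis
  have far: "s * cmod (of_int a - z) < cmod (of_int b - z)"
    if "poly ?F z = 0" "s \<ge> 0" "real_of_int \<bar>b\<bar> > s * real_of_int \<bar>a\<bar> + (1 + s) * M" for s z
  proof -
    \<comment> \<open>The assumption on \<open>b\<close> rearranges to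
      \<open>s * (\<bar>a\<bar> + M) < \<bar>b\<bar> - M\<close>, and the triangle inequality bounds
      the two distances to \<open>z\<close> by these brackets.\<close>
    have "cmod (of_int a - z) \<le> \<bar>a\<bar> + M"
      using norm_triangle_ineq4[of "of_int a" z] M[OF that(1)] by simp
    then have "s * cmod (of_int a - z) \<le> s * (\<bar>a\<bar> + M)"
      using that(2) by (intro mult_left_mono) auto
    also have "\<dots> < \<bar>b\<bar> - M" using that(3) by (simp add: algebra_simps)
    also have "\<dots> \<le> cmod (of_int b - z)"
      using norm_triangle_ineq2[of "of_int b" z] M[OF that(1)] by simp
    finally show ?thesis .
  qed
  have "irreducible (map_poly rat_of_int f)"
    if "real_of_int \<bar>b\<bar> > q * real_of_int \<bar>a\<bar> + (1 + q) * M"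
  proof (rule ccontr)
    assume red: "\<not> ?thesis"
    have "\<exists>g. g dvd f \<and> degree g > 0 \<and> q ^ degree g < q"
      using q1 that by (intro factor[OF red] far) auto
    then obtain g :: "int poly" where "degree g > 0" "q ^ degree g < q" by blast
    then show False using self_le_power[OF q1, of "degree g"] by simp
  qed
  moreover have "irreducible (map_poly rat_of_int f)"
    if "real_of_int \<bar>b\<bar> > sqrt q * real_of_int \<bar>a\<bar> + (1 + sqrt q) * M"
      and noroot: "\<forall>x :: rat. poly (map_poly rat_of_int f) x \<noteq> 0"
  proof (rule ccontr)
    assume red: "\<not> ?thesis"
    have "\<exists>g. g dvd f \<and> degree g > 0 \<and> sqrt q ^ degree g < q"
      using q1 that(1) by (intro factor[OF red] far) auto
    then obtain g where g: "g dvd f" "degree g > 0" "sqrt q ^ degree g < q" by blast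
    have "degree g \<noteq> 1"
    proof
      assume "degree g = 1"
      then obtain x where "poly (map_poly rat_of_int g) x = 0" by (rule degree_1_imp_rat_root)
      with g(1) noroot show False by (auto simp: map_poly_of_int_mult)
    qed
    \<comment> \<open>The degree is now at least 2 and \<open>sqrt q \<ge> 1\<close>, so the power
      is at least \<open>q\<close>.\<close>
    then have "sqrt q ^ 2 \<le> sqrt q ^ degree g"
      using g(2) q1 by (intro power_increasing) auto
    then show False using g(3) q1 by simp
  qed
  moreover have "irreducible (map_poly rat_of_int f)"
    if "q = 1" and ab: "a\<^sup>2 < b\<^sup>2" and Mab: "M < real_of_int \<bar>a + b\<bar> / 2"
  proof (rule ccontr)
    assume red: "\<not> ?thesis"
    have "1 * cmod (of_int a - z) < cmod (of_int b - z)" if "poly ?F z = 0" for z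
    proof -
      have Re: "2 * \<bar>Re z\<bar> < real_of_int \<bar>a + b\<bar>"
        using M[OF that] abs_Re_le_cmod[of z] Mab by simp
      have "(b - a) * (b + a) > 0" using ab by (simp add: power2_eq_square algebra_simps)
      \<comment> \<open>The product equals \<open>\<bar>b - z\<bar>^2 - \<bar>a - z\<bar>^2\<close>.
        Its second factor has the sign of \<open>a + b\<close>, so the product has the sign of
        \<open>b^2 - a^2\<close>.\<close>
      then have "real_of_int (b - a) * (real_of_int (a + b) - 2 * Re z) > 0"
        using Re by (auto simp: zero_less_mult_iff)
      then have "(cmod (of_int a - z))\<^sup>2 < (cmod (of_int b - z))\<^sup>2"
        unfolding cmod_power2 by (simp add: power2_eq_square algebra_simps)
      then show ?thesis by (simp add: power2_less_imp_less)
    qed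
    then have "\<exists>g. g dvd f \<and> degree g > 0 \<and> 1 ^ degree g < q"
      by (intro factor[OF red]) auto
    then show False using \<open>q = 1\<close> by simp
  qed
  ultimately show ?thesis by blast
qed

end
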